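(* Let $A\in\mathbb{R}^{n\times n}$ be stable. Then the function $g(p) = \operatorname{tr}\left(W_{\rm con}(p)^{-1}\right)$ is strictly convex on $\mathcal{F} = X\cap\Delta$.
   Context: A real square matrix $A$ is called stable if all of its eigenvalues have negative real part. For stable $A\in\mathbb{R}^{n\times n}$ and $i=1,\dots,n$ put $W_i := \int_0^\infty \exp(At)\, e_i e_i^\top \exp(A^\top t)\, dt$, where $e_i\in\mathbb{R}^n$ is the $i$-th standard basis vector. For $p=(p_1,\dots,p_n)\in\mathbb{R}^n$ put $W_{\rm con}(p) := \sum_{i=1}^n p_i W_i$. Let $X := \{p\in\mathbb{R}^n \mid W_{\rm con}(p)\succ O\}$ (positive definite), $\Delta := \{p\in\mathbb{R}^n \mid \sum_{i=1}^n p_i = 1,\ p_i\ge 0 \ (i=1,\dots,n)\}$, and $\mathcal{F} := X\cap\Delta$. The function $g$ is defined on $X$ by $g(p) := \operatorname{tr}(W_{\rm con}(p)^{-1})$. *)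

theory Defs
  imports "HOL-Analysis.Analysis"
begin

text \<open>
  Power and exponential of a square matrix. The overloaded product and power on
  \<^typ>\<open>real^'n^'n\<close> are componentwise, so the library constant \<^const>\<open>exp\<close> is not
  the matrix exponential; both notions are built here on the matrix product \<open>**\<close>.
\<close>

primrec matrix_power :: "real^'n^'n \<Rightarrow> nat \<Rightarrow> real^'n^'n" where
  "matrix_power A 0 = mat 1"
| "matrix_power A (Suc k) = A ** matrix_power A k"

definition matrix_exp :: "real^'n^'n \<Rightarrow> real^'n^'n" where
  "matrix_exp A = (\<Sum>k. (1 / fact k) *\<^sub>R matrix_power A k)"

text \<open>The eigenvalues of a real matrix are its complex ones.\<close>

definition matrix_eigenvalue :: "real^'n^'n \<Rightarrow> complex \<Rightarrow> bool" where
  "matrix_eigenvalue A z \<longleftrightarrow>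
     (\<exists>v :: complex^'n. v \<noteq> 0 \<and> map_matrix complex_of_real A *v v = z *s v)"

definition stable_matrix :: "real^'n^'n \<Rightarrow> bool" where
  "stable_matrix A \<longleftrightarrow> (\<forall>z. matrix_eigenvalue A z \<longrightarrow> Re z < 0)"

definition positive_definite :: "real^'n^'n \<Rightarrow> bool" where
  "positive_definite M \<longleftrightarrow> transpose M = M \<and> (\<forall>x. x \<noteq> 0 \<longrightarrow> x \<bullet> (M *v x) > 0)"

text \<open>As for \<^const>\<open>convex_on\<close>, convexity of the domain is part of the notion.\<close>

definition strictly_convex_on :: "'a::real_vector set \<Rightarrow> ('a \<Rightarrow> real) \<Rightarrow> bool" where
  "strictly_convex_on S f \<longleftrightarrow> convex S \<and>
     (\<forall>x\<in>S. \<forall>y\<in>S. x \<noteq> y \<longrightarrow>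
        (\<forall>u>0. \<forall>v>0. u + v = 1 \<longrightarrow> f (u *\<^sub>R x + v *\<^sub>R y) < u * f x + v * f y))"

definition W_node :: "real^'n^'n \<Rightarrow> 'n \<Rightarrow> real^'n^'n" where
  "W_node A i = integral {0..} (\<lambda>t :: real.
     matrix_exp (t *\<^sub>R A) **
       ((columnvector (axis i 1) :: real^1^'n) ** (rowvector (axis i 1) :: real^'n^1)) **
     matrix_exp (t *\<^sub>R transpose A))"

definition W_con :: "real^'n^'n \<Rightarrow> real^'n \<Rightarrow> real^'n^'n" where
  "W_con A p = (\<Sum>i\<in>UNIV. (p $ i) *\<^sub>R W_node A i)"

definition X_con :: "real^'n^'n \<Rightarrow> (real^'n) set" where
  "X_con A = {p. positive_definite (W_con A p)}"

definition \<Delta> :: "(real^'n) set" where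
  "\<Delta> = {p. (\<Sum>i\<in>UNIV. p $ i) = 1 \<and> (\<forall>i. p $ i \<ge> 0)}"

definition \<F> :: "real^'n^'n \<Rightarrow> (real^'n) set" where
  "\<F> A = X_con A \<inter> \<Delta>"

text \<open>Only the values on \<^term>\<open>X_con A\<close>, where the inverse exists, are meaningful.\<close>

definition g_con :: "real^'n^'n \<Rightarrow> real^'n \<Rightarrow> real" where
  "g_con A p = trace (matrix_inv (W_con A p))"

end

theory Submission
  imports Defs "HOL-Computational_Algebra.Fundamental_Theorem_Algebra"
begin

text \<open>
  Stability makes \<open>exp (A t)\<close> decay exponentially, so the integrals \<open>W\<^sub>i\<close> converge and satisfy the
  Lyapunov equation \<open>A W\<^sub>i + W\<^sub>i A\<^sup>T = - e\<^sub>i e\<^sub>i\<^sup>T\<close>. By linearity \<open>A W + W A\<^sup>T = - diag p\<close> for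
  \<open>W = W_con A p\<close>, so the linear map \<open>p \<mapsto> W_con A p\<close> is injective. It therefore suffices that
  \<open>M \<mapsto> tr M\<^sup>-\<^sup>1\<close> is strictly convex on positive definite matrices, and this follows from
  \<open>y \<bullet> M\<^sup>-\<^sup>1 y = max\<^sub>z (2 z \<bullet> y - z \<bullet> M z)\<close>, a maximum of functions affine in \<open>M\<close>, attained only
  at \<open>z = M\<^sup>-\<^sup>1 y\<close>.
\<close>

unbundle no fps_syntax

subsection \<open>The matrix exponential\<close>

lemma bounded_linear_matrix_mult_left: "bounded_linear (\<lambda>M::real^'n^'n. A ** M)"
  unfolding linear_conv_bounded_linear[symmetric]
  by (rule linearI) (simp_all add: matrix_add_ldistrib matrix_scalar_ac scalar_matrix_assoc[symmetric])

lemma bounded_linear_matrix_mult_right: "bounded_linear (\<lambda>M::real^'n^'n. M ** A)"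
  unfolding linear_conv_bounded_linear[symmetric]
  by (rule linearI) (simp_all add: matrix_matrix_mult_def vec_eq_iff distrib_right sum.distrib sum_distrib_left mult.assoc)

lemma bounded_linear_transpose: "bounded_linear (transpose :: real^'n^'n \<Rightarrow> real^'n^'n)"
  unfolding linear_conv_bounded_linear[symmetric]
  by (rule linearI) (simp_all add: transpose_def vec_eq_iff)

lemma bounded_linear_matrix_entry: "bounded_linear (\<lambda>M::real^'n^'n. M $ i $ j)"
  by (intro bounded_linear_compose[OF bounded_linear_vec_nth] bounded_linear_vec_nth)

lemma matrix_power_commute: "matrix_power A k ** A = A ** matrix_power A k"
  by (induction k) (simp_all add: matrix_mul_assoc[symmetric])

lemma matrix_power_scaleR: "matrix_power (t *\<^sub>R A) k = t ^ k *\<^sub>R matrix_power A k"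
  by (induction k) (simp_all add: matrix_scalar_ac scalar_matrix_assoc[symmetric] mult.commute)

lemma matrix_power_transpose: "matrix_power (transpose A) k = transpose (matrix_power A k)"
proof (induction k)
  case (Suc k)
  then show ?case
    by (simp add: matrix_transpose_mul[symmetric] matrix_power_commute)
qed (simp add: transpose_mat)

text \<open>Left multiplication by \<open>A\<close> is a bounded operator; with \<open>K\<close> a
  bound for it, each further factor costs at most \<open>K\<close>. This is what the comparison with
  the scalar exponential series requires.\<close>

lemma matrix_power_bound:
  fixes A :: "real^'n^'n"
  shows "\<exists>C K. \<forall>k. norm (matrix_power A k) \<le> C * K ^ k"
proof -
  obtain K where K: "K > 0" "\<forall>M::real^'n^'n. norm (A ** M) \<le> norm M * K"
    using bounded_linear.pos_bounded[OF bounded_linear_matrix_mult_left[of A]] by blast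
  have "norm (matrix_power A k) \<le> norm (mat 1 :: real^'n^'n) * K ^ k" for k
  proof (induction k)
    case (Suc k)
    have "norm (matrix_power A (Suc k)) \<le> norm (matrix_power A k) * K"
      using K(2) by simp
    also have "\<dots> \<le> (norm (mat 1 :: real^'n^'n) * K ^ k) * K"
      using Suc K(1) by (intro mult_right_mono) auto
    finally show ?case by (simp add: mult_ac)
  qed simp
  then show ?thesis by blast
qed

lemma summable_matrix_exp: "summable (\<lambda>k. (1 / fact k) *\<^sub>R matrix_power A k)"
proof -
  obtain C K where *: "\<forall>k. norm (matrix_power A k) \<le> C * K ^ k"
    using matrix_power_bound[of A] by blast
  have "summable (\<lambda>k. C * (inverse (fact k) * K ^ k))"
    by (intro summable_mult summable_exp)
  then show ?thesis
  proof (rule summable_comparison_test'[where N = 0])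
    fix k :: nat
    show "norm ((1 / fact k) *\<^sub>R matrix_power A k) \<le> C * (inverse (fact k) * K ^ k)"
      using mult_left_mono[OF *[rule_format, of k], of "inverse (fact k)"]
      by (simp add: divide_simps mult_ac)
  qed
qed

text \<open>A bounded linear map passes through a convergent series. Transposes, products with a
  fixed matrix and single entries of the exponential are thereby reduced to those of the
  powers.\<close>

lemma matrix_exp_bounded_linear_image:
  assumes "bounded_linear f"
  shows "f (matrix_exp A) = (\<Sum>k. (1 / fact k) *\<^sub>R f (matrix_power A k))"
proof -
  interpret bounded_linear f by fact
  show ?thesis
    unfolding matrix_exp_def suminf[OF summable_matrix_exp] by (simp add: scaleR)
qed

lemma matrix_exp_transpose: "matrix_exp (transpose A) = transpose (matrix_exp A)"
  unfolding matrix_exp_bounded_linear_image[OF bounded_linear_transpose]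
  by (simp add: matrix_exp_def matrix_power_transpose)

lemma matrix_exp_commute: "A ** matrix_exp (t *\<^sub>R A) = matrix_exp (t *\<^sub>R A) ** A"
  unfolding matrix_exp_bounded_linear_image[OF bounded_linear_matrix_mult_left]
    matrix_exp_bounded_linear_image[OF bounded_linear_matrix_mult_right]
  by (simp add: matrix_power_scaleR matrix_power_commute matrix_scalar_ac scalar_matrix_assoc[symmetric])

lemma matrix_exp_0: "matrix_exp (0 *\<^sub>R A) = mat 1"
proof -
  \<comment> \<open>Only the term \<open>k = 0\<close> survives. The scalar 0 is kept unsimplified
    so that \<open>matrix_power_scaleR\<close> can pull out \<open>0 ^ k\<close>.\<close>
  have "(\<lambda>k. (1 / fact k) *\<^sub>R matrix_power (0 *\<^sub>R A) k) sums
      (\<Sum>k\<in>{0}. (1 / fact k) *\<^sub>R matrix_power (0 *\<^sub>R A) k)"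
    by (rule sums_finite) (auto simp: matrix_power_scaleR power_0_left simp del: scale_zero_left)
  then show ?thesis
    unfolding matrix_exp_def by (simp add: sums_iff)
qed

text \<open>Each entry is a real power series in \<open>t\<close> that converges everywhere, so it
  may be differentiated term by term.\<close>

lemma matrix_exp_entry_has_derivative:
  "((\<lambda>t. matrix_exp (t *\<^sub>R A) $ i $ j) has_field_derivative
     (A ** matrix_exp (t *\<^sub>R A)) $ i $ j) (at t)"
proof -
  define c where "c k = (1 / fact k) * matrix_power A k $ i $ j" for k
  have entry: "matrix_exp (s *\<^sub>R A) $ i $ j = (\<Sum>k. c k * s ^ k)" for s
    unfolding matrix_exp_bounded_linear_image[OF bounded_linear_matrix_entry]
    by (simp add: matrix_power_scaleR c_def mult_ac)
  have summ: "summable (\<lambda>k. c k * s ^ k)" for s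
    using bounded_linear.summable[OF bounded_linear_matrix_entry summable_matrix_exp[of "s *\<^sub>R A"], of i j]
    by (simp add: matrix_power_scaleR c_def mult_ac)
  \<comment> \<open>In \<open>diffs c k = (k + 1) * c (k + 1)\<close> the factor
    \<open>k + 1\<close> cancels against the factorial, and the shifted power supplies the extra
    factor \<open>A\<close>.\<close>
  have "(A ** matrix_exp (t *\<^sub>R A)) $ i $ j = (\<Sum>k. diffs c k * t ^ k)"
    unfolding matrix_exp_bounded_linear_image[OF bounded_linear_compose
        [OF bounded_linear_matrix_entry bounded_linear_matrix_mult_left]]
    by (intro suminf_cong)
      (simp add: matrix_power_scaleR diffs_def c_def matrix_scalar_ac scalar_matrix_assoc[symmetric]
         divide_simps mult_ac del: of_nat_Suc)
  then show ?thesis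
    using termdiffs_strong_converges_everywhere[OF summ, of t] by (simp add: entry)
qed

subsection \<open>Exponential decay\<close>

text \<open>The rate is existentially quantified and may therefore be lowered, which absorbs the
  polynomial factors caused by repeated eigenvalues.\<close>

definition exp_decaying :: "(real \<Rightarrow> 'a::real_normed_vector) \<Rightarrow> bool" where
  "exp_decaying f \<longleftrightarrow> (\<exists>C. \<exists>a>0. \<forall>t\<ge>0. norm (f t) \<le> C * exp (- a * t))"

text \<open>Variation of constants: \<open>exp (- z t) f t\<close> has derivative \<open>exp (- z t) g t\<close>, which is
  integrated against a rate \<open>a\<close> slower than both \<open>- Re z\<close> and the decay rate of \<open>g\<close>.\<close>

lemma exp_decaying_ode:
  fixes f g :: "real \<Rightarrow> complex"
  assumes deriv: "\<And>t. (f has_vector_derivative z * f t + g t) (at t)"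
    and neg: "Re z < 0" and decay: "exp_decaying g"
  shows "exp_decaying f"
proof -
  obtain C b where b: "b > 0" and C: "\<And>t. t \<ge> 0 \<Longrightarrow> cmod (g t) \<le> C * exp (- b * t)"
    using decay unfolding exp_decaying_def by blast
  have "C \<ge> 0"
    using order_trans[OF norm_ge_zero C[of 0]] by simp
  \<comment> \<open>Halving the minimum keeps \<open>a\<close> below \<open>b\<close> and makes
    \<open>c = - Re z - a\<close> strictly positive, so that division by \<open>c\<close> is
    possible.\<close>
  define a where "a = min b (- Re z) / 2"
  define c where "c = - Re z - a"
  have a: "a > 0" "a \<le> b" and c: "c > 0"
    using b neg by (auto simp: a_def c_def min_def)
  define h where "h t = exp (- z * of_real t) * f t" for t
  have exp': "((\<lambda>t. exp (- z * of_real t)) has_vector_derivative - z * exp (- z * of_real t)) (at t)"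
    for t
    by (rule has_vector_derivative_real_field) (auto intro!: derivative_eq_intros)
  have h': "(h has_vector_derivative exp (- z * of_real t) * g t) (at t)" for t
    unfolding h_def
    by (rule has_vector_derivative_eq_rhs[OF has_vector_derivative_mult[OF exp' deriv]])
      (simp add: algebra_simps)
  \<comment> \<open>An antiderivative of \<open>C * exp (c * t)\<close>, which bounds the norm of
    the derivative of \<open>h\<close> because \<open>a \<le> b\<close>.\<close>
  define \<phi> where "\<phi> t = C / c * exp (c * t)" for t
  have \<phi>': "(\<phi> has_vector_derivative C * exp (c * t)) (at t)" for t
    unfolding \<phi>_def has_real_derivative_iff_has_vector_derivative[symmetric]
    using c by (auto intro!: derivative_eq_intros)
  have bound: "cmod (f t) \<le> (cmod (f 0) + C / c) * exp (- a * t)" if "t \<ge> 0" for t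
  proof -
    have "cmod (h t - h 0) \<le> \<phi> t - \<phi> 0"
    proof (cases "t = 0")
      case False
      show ?thesis
      proof (rule differentiable_bound_general[OF _ _ _ h' \<phi>'])
        show "0 < t" using that False by simp
        show "continuous_on {0..t} h" "continuous_on {0..t} \<phi>"
          using h' \<phi>' by (meson continuous_at_imp_continuous_on has_vector_derivative_continuous)+
        fix s :: real assume s: "0 < s" "s < t"
        have "cmod (exp (- z * of_real s) * g s) \<le> exp (- Re z * s) * (C * exp (- b * s))"
          using C[of s] s by (simp add: norm_mult)
        also have "\<dots> = C * exp ((- Re z - b) * s)"
          by (simp add: exp_add[symmetric] algebra_simps)
        also have "\<dots> \<le> C * exp (c * s)"
          using a s \<open>C \<ge> 0\<close> by (intro mult_left_mono) (auto simp: c_def)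
        finally show "cmod (exp (- z * of_real s) * g s) \<le> C * exp (c * s)" .
      qed
    qed simp
    have "cmod (h t) \<le> cmod (h t - h 0) + cmod (h 0)"
      by (metis diff_add_cancel norm_triangle_ineq)
    have "cmod (h t) \<le> cmod (f 0) + C / c * exp (c * t)"
    proof -
      have "h 0 = f 0" "\<phi> 0 = C / c" by (simp_all add: h_def \<phi>_def)
      moreover have "C / c \<ge> 0" using \<open>C \<ge> 0\<close> c by simp
      ultimately show ?thesis
        using \<open>cmod (h t - h 0) \<le> \<phi> t - \<phi> 0\<close> \<open>cmod (h t) \<le> cmod (h t - h 0) + cmod (h 0)\<close>
        unfolding \<phi>_def[of t] by simp
    qed
    also have "\<dots> \<le> cmod (f 0) * exp (c * t) + C / c * exp (c * t)"
      using c that mult_left_mono[of 1 "exp (c * t)" "cmod (f 0)"] by simp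
    \<comment> \<open>Multiplying by \<open>exp (Re z * t)\<close> turns \<open>h\<close> back into
      \<open>f\<close>, and the exponents combine as \<open>c + Re z = - a\<close>.\<close>
    finally have "cmod (h t) * exp (Re z * t) \<le> (cmod (f 0) + C / c) * exp (c * t) * exp (Re z * t)"
      by (intro mult_right_mono) (simp_all add: distrib_right)
    also have "\<dots> = (cmod (f 0) + C / c) * exp (- a * t)"
      by (simp add: mult.assoc exp_add[symmetric] c_def algebra_simps)
    also have "cmod (h t) * exp (Re z * t) = cmod (f t)"
    proof -
      have "cmod (h t) = exp (- (Re z * t)) * cmod (f t)" by (simp add: h_def norm_mult)
      then show ?thesis by (simp add: exp_minus field_simps)
    qed
    finally show ?thesis .
  qed
  show ?thesis
    unfolding exp_decaying_def using a(1) bound by blast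
qed

section \<open>Polynomials of a matrix acting on vectors\<close>

text \<open>The vector \<open>q(M) v\<close>, computed by Horner's scheme. Acting on vectors avoids
  forming polynomials of the matrix itself.\<close>

definition poly_apply :: "'a::field^'n^'n \<Rightarrow> 'a poly \<Rightarrow> 'a^'n \<Rightarrow> 'a^'n" where
  "poly_apply M q v = fold_coeffs (\<lambda>c w. c *s v + M *v w) q 0"

lemma poly_apply_0 [simp]: "poly_apply M 0 v = 0"
  by (simp add: poly_apply_def)

lemma poly_apply_pCons [simp]: "poly_apply M (pCons c q) v = c *s v + M *v poly_apply M q v"
  by (cases "q = 0"; cases "c = 0") (simp_all add: poly_apply_def)

lemma poly_apply_add: "poly_apply M (p + q) v = poly_apply M p v + poly_apply M q v"
  by (induction p q rule: poly_induct2)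
    (simp_all add: vec.scale_left_distrib matrix_vector_right_distrib algebra_simps)

lemma poly_apply_smult: "poly_apply M (smult c q) v = c *s poly_apply M q v"
  by (induction q) (simp_all add: vec.scale_right_distrib vector_scalar_commute)

lemma poly_apply_sum: "poly_apply M (\<Sum>k\<in>S. p k) v = (\<Sum>k\<in>S. poly_apply M (p k) v)"
  by (induction S rule: infinite_finite_induct) (simp_all add: poly_apply_add)

lemma poly_apply_linear_factor:
  "poly_apply M ([:-z, 1:] * q) v = M *v poly_apply M q v - z *s poly_apply M q v"
proof -
  have "[:-z, 1:] * q = pCons 0 q + smult (- z) q" by simp
  then show ?thesis
    by (simp only: poly_apply_add poly_apply_smult) simp
qed

text \<open>\<open>q(M)\<close> commutes with \<open>M - z\<close>. Hence if
  \<open>(x - z) q\<close> annihilates \<open>v\<close>, then \<open>q\<close> annihilates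
  \<open>(M - z) v\<close>, which lowers the degree in the later induction.\<close>

lemma poly_apply_shift:
  "poly_apply M q (M *v v - z *s v) = M *v poly_apply M q v - z *s poly_apply M q v"
proof (induction q)
  case (pCons c q)
  show ?case
    unfolding poly_apply_pCons pCons.IH
    by (simp add: vec.scale_right_distrib vec.scale_right_diff_distrib vector_scalar_commute
        matrix_vector_right_distrib algebra_simps)
qed simp

abbreviation complex_matrix :: "real^'n^'n \<Rightarrow> complex^'n^'n" where
  "complex_matrix \<equiv> map_matrix complex_of_real"

lemma complex_matrix_mult_vector:
  "complex_matrix (A ** B) *v v = complex_matrix A *v (complex_matrix B *v v)"
proof -
  have "complex_matrix (A ** B) = complex_matrix A ** complex_matrix B"
    by (simp add: vec_eq_iff matrix_matrix_mult_def)
  then show ?thesis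
    by (simp add: matrix_vector_mul_assoc)
qed

lemma poly_apply_monom:
  fixes A :: "real^'n^'n"
  shows "poly_apply (complex_matrix A) (monom c k) v = c *s (complex_matrix (matrix_power A k) *v v)"
proof (induction k)
  case 0
  have "complex_matrix (mat 1 :: real^'n^'n) = mat 1"
    by (simp add: vec_eq_iff mat_def)
  then show ?case by (simp add: monom_0)
qed (simp add: monom_Suc complex_matrix_mult_vector vector_scalar_commute)

text \<open>There are \<open>N + 1\<close> powers in a space of dimension \<open>N\<close>.
  Dependence of their set yields coefficients only if the powers are distinct; otherwise two equal
  powers give a relation with coefficients 1 and -1.\<close>

lemma matrix_powers_dependent:
  fixes A :: "real^'n^'n"
  shows "\<exists>c N. (\<exists>k\<le>N. c k \<noteq> (0::real)) \<and> (\<Sum>k\<le>N. c k *\<^sub>R matrix_power A k) = 0"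
proof -
  define N where "N = DIM(real^'n^'n)"
  show ?thesis
  proof (cases "inj_on (matrix_power A) {..N}")
    case True
    then have "dependent (matrix_power A ` {..N})"
      by (intro dependent_biggerset) (simp add: card_image N_def)
    then obtain u where u: "\<exists>v\<in>matrix_power A ` {..N}. u v \<noteq> 0"
      "(\<Sum>v\<in>matrix_power A ` {..N}. u v *\<^sub>R v) = 0"
      by (auto simp: dependent_finite)
    then show ?thesis
      using True by (intro exI[of _ "u \<circ> matrix_power A"] exI[of _ N]) (auto simp: sum.reindex)
  next
    case False
    then obtain i j where ij: "i \<le> N" "j \<le> N" "i \<noteq> j" "matrix_power A i = matrix_power A j"
      by (auto simp: inj_on_def)
    define c :: "nat \<Rightarrow> real" where "c k = (if k = i then 1 else 0) - (if k = j then 1 else 0)" for k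
    have "(\<Sum>k\<le>N. c k *\<^sub>R matrix_power A k) = matrix_power A i - matrix_power A j"
      using ij by (simp add: c_def scaleR_left_diff_distrib sum_subtractf if_distrib[of "\<lambda>x. x *\<^sub>R _"] cong: if_cong)
    moreover have "c i \<noteq> 0"
      using ij by (simp add: c_def)
    ultimately show ?thesis
      using ij by (metis eq_iff_diff_eq_0)
  qed
qed

text \<open>A weak substitute for Cayley-Hamilton: the linear relation between the powers, read as a
  complex polynomial.\<close>

lemma annihilating_poly_exists:
  fixes A :: "real^'n^'n"
  shows "\<exists>q. q \<noteq> 0 \<and> (\<forall>v. poly_apply (complex_matrix A) q v = 0)"
proof -
  obtain c :: "nat \<Rightarrow> real" and N k where k: "k \<le> N" "c k \<noteq> 0"
    and dep: "(\<Sum>k\<le>N. c k *\<^sub>R matrix_power A k) = 0"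
    using matrix_powers_dependent[of A] by blast
  define q where "q = (\<Sum>k\<le>N. monom (complex_of_real (c k)) k)"
  have "coeff q k = c k"
    using k by (simp add: q_def coeff_sum)
  then have "q \<noteq> 0"
    using k by auto
  moreover have "poly_apply (complex_matrix A) q v = 0" for v
  proof -
    have "poly_apply (complex_matrix A) q v = complex_matrix (\<Sum>k\<le>N. c k *\<^sub>R matrix_power A k) *v v"
      by (simp add: q_def poly_apply_sum poly_apply_monom vec_eq_iff matrix_vector_mult_def
          sum_distrib_left sum_distrib_right mult.assoc) (intro allI, rule sum.swap)
    then show ?thesis
      by (simp add: dep vec_eq_iff matrix_vector_mult_def)
  qed
  ultimately show ?thesis by blast
qed

text \<open>Commutation puts \<open>A\<close> next to \<open>v\<close>, so the derivative is the
  same kind of function with \<open>A v\<close> in place of \<open>v\<close>.\<close>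

lemma matrix_exp_vector_has_derivative:
  fixes A :: "real^'n^'n" and v :: "complex^'n"
  shows "((\<lambda>t. (complex_matrix (matrix_exp (t *\<^sub>R A)) *v v) $ i) has_vector_derivative
     (complex_matrix (matrix_exp (t *\<^sub>R A)) *v (complex_matrix A *v v)) $ i) (at t)"
proof -
  have "((\<lambda>t. (complex_matrix (matrix_exp (t *\<^sub>R A)) *v v) $ i) has_vector_derivative
     (complex_matrix (A ** matrix_exp (t *\<^sub>R A)) *v v) $ i) (at t)"
    unfolding matrix_vector_mult_def
    by (simp, intro has_vector_derivative_sum has_vector_derivative_mult_left
        has_vector_derivative_of_real matrix_exp_entry_has_derivative)
  then show ?thesis
    by (simp only: matrix_exp_commute complex_matrix_mult_vector)
qed

text \<open>Induction on the degree of an annihilating polynomial \<open>q = (x - z) r\<close>: a root \<open>z\<close> with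
  negative real part is removed by passing to \<open>(A - z) v\<close> and integrating, any other root is no
  eigenvalue, so that already \<open>r\<close> annihilates \<open>v\<close>.\<close>

lemma exp_decaying_of_annihilating_poly:
  fixes A :: "real^'n^'n" and v :: "complex^'n"
  assumes stable: "stable_matrix A"
  shows "q \<noteq> 0 \<Longrightarrow> poly_apply (complex_matrix A) q v = 0 \<Longrightarrow>
    exp_decaying (\<lambda>t. (complex_matrix (matrix_exp (t *\<^sub>R A)) *v v) $ i)"
proof (induction "degree q" arbitrary: q v i)
  case 0
  then obtain c where "q = [:c:]" "c \<noteq> 0"
    by (metis degree_eq_zeroE pCons_0_0)
  with 0 have "v = 0" by simp
  then show ?case
    by (auto simp: exp_decaying_def intro!: exI[of _ 0] exI[of _ 1])
next
  case (Suc d)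
  let ?M = "complex_matrix A"
  have "\<not> constant (poly q)"
    using Suc.hyps(2) by (simp add: constant_degree)
  then obtain z where "poly q z = 0"
    using fundamental_theorem_of_algebra by blast
  then obtain r where q: "q = [:-z, 1:] * r"
    by (auto simp: poly_eq_0_iff_dvd dvd_def)
  with Suc.prems have "r \<noteq> 0" by auto
  then have "degree q = Suc (degree r)"
    unfolding q by (subst degree_mult_eq) auto
  then have r: "degree r = d"
    using Suc.hyps(2) by simp
  have kernel: "?M *v poly_apply ?M r v - z *s poly_apply ?M r v = 0"
    using Suc.prems(2) unfolding q poly_apply_linear_factor .
  show ?case
  proof (cases "Re z < 0")
    case True
    have g: "exp_decaying (\<lambda>t. (complex_matrix (matrix_exp (t *\<^sub>R A)) *v (?M *v v - z *s v)) $ j)" for j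
      using Suc.hyps(1)[OF r[symmetric] \<open>r \<noteq> 0\<close>] kernel by (simp add: poly_apply_shift)
    \<comment> \<open>With \<open>f\<close> the \<open>i\<close>-th entry of
      \<open>exp (t A) v\<close> and \<open>g\<close> that of \<open>exp (t A) (A - z) v\<close>,
      the equation is \<open>f' = z f + g\<close>.\<close>
    show ?thesis
      by (rule exp_decaying_ode[OF _ True g[of i], rule_format])
        (rule has_vector_derivative_eq_rhs[OF matrix_exp_vector_has_derivative],
         simp add: matrix_vector_mult_diff_distrib vector_scalar_commute)
  next
    case False
    then have "poly_apply ?M r v = 0"
      using stable kernel unfolding stable_matrix_def matrix_eigenvalue_def by fastforce
    then show ?thesis
      using Suc.hyps(1)[OF r[symmetric] \<open>r \<noteq> 0\<close>] by blast
  qed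
qed

lemma stable_matrix_exp_decaying:
  fixes A :: "real^'n^'n"
  assumes "stable_matrix A"
  shows "exp_decaying (\<lambda>t. matrix_exp (t *\<^sub>R A) $ i $ j)"
proof -
  obtain q where "q \<noteq> 0" "\<And>v. poly_apply (complex_matrix A) q v = 0"
    using annihilating_poly_exists by blast
  \<comment> \<open>Applied to a standard basis vector, the exponential gives its
    \<open>j\<close>-th column.\<close>
  then have "exp_decaying (\<lambda>t. (complex_matrix (matrix_exp (t *\<^sub>R A)) *v axis j 1) $ i)"
    using exp_decaying_of_annihilating_poly[OF assms] by blast
  then show ?thesis
    by (simp add: matrix_vector_mult_def axis_def if_distrib exp_decaying_def cong: if_cong)
qed

subsection \<open>Strict convexity of the trace of the inverse\<close>

lemma positive_definite_invertible:
  assumes "positive_definite M"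
  shows "invertible M"
proof -
  have "x = 0" if "M *v x = 0" for x
    using assms that unfolding positive_definite_def by (metis inner_zero_right less_irrefl)
  then show ?thesis
    by (auto simp: invertible_left_inverse matrix_left_invertible_ker)
qed

lemma matrix_inv_right:
  assumes "invertible M"
  shows "M ** matrix_inv M = mat 1"
  using assms unfolding invertible_def matrix_inv_def by (metis (mono_tags, lifting) someI_ex)

lemma trace_eq_sum_inner: "trace M = (\<Sum>i\<in>UNIV. axis i 1 \<bullet> (M *v axis i 1))"
  for M :: "real^'n^'n"
  by (simp add: trace_def inner_axis' matrix_vector_mult_basis column_def)

lemma positive_definite_add:
  assumes "positive_definite M" "positive_definite N" "u > 0" "v > 0"
  shows "positive_definite (u *\<^sub>R M + v *\<^sub>R N)"
proof -
  have "x \<bullet> ((u *\<^sub>R M + v *\<^sub>R N) *v x) = u * (x \<bullet> (M *v x)) + v * (x \<bullet> (N *v x))" for x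
    by (simp add: matrix_vector_mult_add_rdistrib scaleR_matrix_vector_assoc[symmetric] inner_add_right)
  with assms show ?thesis
    by (auto simp: positive_definite_def transpose_def vec_eq_iff add_pos_pos)
qed

text \<open>Completing the square around \<open>z = matrix_inv M *v y\<close>.\<close>

lemma inner_inverse_variational:
  assumes pd: "positive_definite M"
  shows "2 * (z \<bullet> y) - z \<bullet> (M *v z) \<le> y \<bullet> (matrix_inv M *v y)"
    and "2 * (z \<bullet> y) - z \<bullet> (M *v z) = y \<bullet> (matrix_inv M *v y) \<Longrightarrow> z = matrix_inv M *v y"
proof -
  define w where "w = matrix_inv M *v y"
  have Mw: "M *v w = y"
    by (simp add: w_def matrix_vector_mul_assoc matrix_inv_right positive_definite_invertible pd)
  \<comment> \<open>Symmetry of \<open>M\<close> moves it onto \<open>w\<close>.\<close>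
  have "w \<bullet> (M *v z) = y \<bullet> z"
    using pd Mw by (metis dot_lmul_matrix positive_definite_def vector_transpose_matrix)
  then have eq: "(z - w) \<bullet> (M *v (z - w)) = y \<bullet> w - (2 * (z \<bullet> y) - z \<bullet> (M *v z))"
    using Mw by (simp add: matrix_vector_mult_diff_distrib algebra_simps inner_commute)
  have "(z - w) \<bullet> (M *v (z - w)) \<ge> 0"
    using pd unfolding positive_definite_def by (cases "z - w = 0") (auto simp: less_imp_le)
  with eq show "2 * (z \<bullet> y) - z \<bullet> (M *v z) \<le> y \<bullet> (matrix_inv M *v y)"
    by (simp add: w_def)
  assume "2 * (z \<bullet> y) - z \<bullet> (M *v z) = y \<bullet> (matrix_inv M *v y)"
  with eq have "(z - w) \<bullet> (M *v (z - w)) = 0"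
    by (simp add: w_def)
  then show "z = matrix_inv M *v y"
    using pd unfolding positive_definite_def w_def by (metis eq_iff_diff_eq_0 less_irrefl)
qed

text \<open>The maximizer \<open>z\<close> for \<open>S\<close> is inserted into the variational
  expressions of \<open>M\<close> and \<open>N\<close>. These are affine in the matrix, so their
  weighted sum is the value for \<open>S\<close>. Equality makes \<open>z\<close> the maximizer for
  both matrices, whence both inverses send \<open>y\<close> to \<open>z\<close>.\<close>

lemma inner_inverse_convex:
  assumes M: "positive_definite M" and N: "positive_definite N"
    and uv: "u > 0" "v > 0" "u + v = 1"
  defines "S \<equiv> u *\<^sub>R M + v *\<^sub>R N"
  shows "y \<bullet> (matrix_inv S *v y) \<le> u * (y \<bullet> (matrix_inv M *v y)) + v * (y \<bullet> (matrix_inv N *v y))"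
    and "y \<bullet> (matrix_inv S *v y) = u * (y \<bullet> (matrix_inv M *v y)) + v * (y \<bullet> (matrix_inv N *v y))
      \<Longrightarrow> matrix_inv M *v y = matrix_inv N *v y"
proof -
  define z where "z = matrix_inv S *v y"
  have "positive_definite S"
    unfolding S_def using M N uv by (intro positive_definite_add)
  then have Sz: "S *v z = y"
    by (simp add: z_def matrix_vector_mul_assoc matrix_inv_right positive_definite_invertible)
  have "z \<bullet> (S *v z) = u * (z \<bullet> (M *v z)) + v * (z \<bullet> (N *v z))"
    by (simp add: S_def matrix_vector_mult_add_rdistrib scaleR_matrix_vector_assoc[symmetric] inner_add_right)
  moreover have "2 * (z \<bullet> y) = u * (2 * (z \<bullet> y)) + v * (2 * (z \<bullet> y))"
    using uv(3) by (metis mult_1 distrib_right)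
  ultimately have eq: "y \<bullet> z = u * (2 * (z \<bullet> y) - z \<bullet> (M *v z)) + v * (2 * (z \<bullet> y) - z \<bullet> (N *v z))"
    using Sz by (simp add: right_diff_distrib inner_commute)
  note vM = inner_inverse_variational[OF M, of z y] and vN = inner_inverse_variational[OF N, of z y]
  have le: "u * (2 * (z \<bullet> y) - z \<bullet> (M *v z)) \<le> u * (y \<bullet> (matrix_inv M *v y))"
    "v * (2 * (z \<bullet> y) - z \<bullet> (N *v z)) \<le> v * (y \<bullet> (matrix_inv N *v y))"
    using vM(1) vN(1) uv by (simp_all only: mult_le_cancel_left_pos)
  show "y \<bullet> (matrix_inv S *v y) \<le> u * (y \<bullet> (matrix_inv M *v y)) + v * (y \<bullet> (matrix_inv N *v y))"
    using eq le by (simp add: z_def)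
  assume "y \<bullet> (matrix_inv S *v y) = u * (y \<bullet> (matrix_inv M *v y)) + v * (y \<bullet> (matrix_inv N *v y))"
  \<comment> \<open>Two inequalities whose sums agree must both be equalities.\<close>
  then have "u * (2 * (z \<bullet> y) - z \<bullet> (M *v z)) = u * (y \<bullet> (matrix_inv M *v y))"
    "v * (2 * (z \<bullet> y) - z \<bullet> (N *v z)) = v * (y \<bullet> (matrix_inv N *v y))"
    using eq le unfolding z_def by linarith+
  then show "matrix_inv M *v y = matrix_inv N *v y"
    using vM(2) vN(2) uv by (metis less_irrefl mult_left_cancel)
qed

text \<open>The trace sums the quadratic forms at the basis vectors. Equality at all of them would
  make the inverses agree in every column, contradicting \<open>M \<noteq> N\<close>.\<close>

lemma trace_inverse_strictly_convex:
  assumes M: "positive_definite M" and N: "positive_definite N" and "M \<noteq> N"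
    and uv: "u > 0" "v > 0" "u + v = 1"
  shows "trace (matrix_inv (u *\<^sub>R M + v *\<^sub>R N)) < u * trace (matrix_inv M) + v * trace (matrix_inv N)"
proof -
  let ?q = "\<lambda>P i. axis i 1 \<bullet> (matrix_inv P *v axis i 1)"
  let ?S = "u *\<^sub>R M + v *\<^sub>R N"
  have le: "?q ?S i \<le> u * ?q M i + v * ?q N i" for i
    by (rule inner_inverse_convex(1)[OF M N uv])
  have "\<exists>i. ?q ?S i \<noteq> u * ?q M i + v * ?q N i"
  proof (rule ccontr)
    assume "\<not> ?thesis"
    then have "matrix_inv M *v axis i 1 = matrix_inv N *v axis i 1" for i
      using inner_inverse_convex(2)[OF M N uv] by blast
    then have "matrix_inv M = matrix_inv N"
      by (simp add: matrix_vector_mult_basis column_def vec_eq_iff)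
    then have "N ** (matrix_inv N ** M) = N ** mat 1"
      using matrix_inv_right[OF positive_definite_invertible[OF M]]
      by (metis matrix_left_right_inverse)
    then have "M = N"
      by (simp add: matrix_mul_assoc matrix_inv_right positive_definite_invertible N)
    with \<open>M \<noteq> N\<close> show False ..
  qed
  then obtain i where "?q ?S i < u * ?q M i + v * ?q N i"
    using le by (meson order_less_le)
  then have "(\<Sum>i\<in>UNIV. ?q ?S i) < (\<Sum>i\<in>UNIV. u * ?q M i + v * ?q N i)"
    using le by (intro sum_strict_mono_ex1) auto
  then show ?thesis
    by (simp add: trace_eq_sum_inner sum.distrib sum_distrib_left)
qed

subsection \<open>The Lyapunov equation\<close>

lemma absolutely_integrable_exp_decaying:
  fixes f :: "real \<Rightarrow> real"
  assumes cont: "continuous_on {0..} f" and decay: "exp_decaying f"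
  shows "set_integrable lebesgue {0..} f"
proof -
  obtain C a where a: "a > 0" and C: "\<And>t. t \<ge> 0 \<Longrightarrow> norm (f t) \<le> C * exp (- a * t)"
    using decay unfolding exp_decaying_def by blast
  have "(\<lambda>t. C * exp (- a * t)) integrable_on {0..}"
    using integrable_on_exp_minus_to_infinity[OF a, of 0] by (rule integrable_on_mult_right)
  then show ?thesis
    using C by (intro measurable_bounded_by_integrable_imp_absolutely_integrable
        continuous_imp_measurable_on_sets_lebesgue cont) auto
qed

lemma exp_decaying_mult:
  fixes f g :: "real \<Rightarrow> real"
  assumes "exp_decaying f" "exp_decaying g"
  shows "exp_decaying (\<lambda>t. f t * g t)"
proof -
  obtain C a where a: "a > 0" and C: "\<And>t. t \<ge> 0 \<Longrightarrow> \<bar>f t\<bar> \<le> C * exp (- a * t)"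
    using assms(1) unfolding exp_decaying_def by auto
  obtain D b where b: "b > 0" and D: "\<And>t. t \<ge> 0 \<Longrightarrow> \<bar>g t\<bar> \<le> D * exp (- b * t)"
    using assms(2) unfolding exp_decaying_def by auto
  have "\<bar>f t * g t\<bar> \<le> (C * D) * exp (- (a + b) * t)" if "t \<ge> 0" for t
  proof -
    have "\<bar>f t\<bar> * \<bar>g t\<bar> \<le> (C * exp (- a * t)) * (D * exp (- b * t))"
      using C[OF that] D[OF that] by (intro mult_mono) (auto intro: order_trans[OF abs_ge_zero])
    then show ?thesis
      by (simp add: abs_mult exp_add[symmetric] algebra_simps)
  qed
  moreover have "a + b > 0" using a b by simp
  ultimately show ?thesis
    unfolding exp_decaying_def real_norm_def by blast
qed

lemma exp_decaying_tendsto_0: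
  assumes "exp_decaying f"
  shows "(f \<longlongrightarrow> 0) at_top"
proof -
  obtain C a where a: "a > 0" and C: "\<And>t. t \<ge> 0 \<Longrightarrow> norm (f t) \<le> C * exp (- a * t)"
    using assms unfolding exp_decaying_def by blast
  have "((\<lambda>t. C * exp (- a * t)) \<longlongrightarrow> 0) at_top"
    using a by real_asymp
  then show ?thesis
    by (rule Lim_null_comparison[rotated]) (use C in \<open>auto intro: eventually_at_top_linorderI[of 0]\<close>)
qed

text \<open>The fundamental theorem on \<open>{0..b}\<close>, with \<open>b\<close> tending to
  infinity: \<open>F b\<close> vanishes by decay, and absolute integrability makes the integrals
  converge to the one over the half-line.\<close>

lemma integral_derivative_exp_decaying:
  fixes F f :: "real \<Rightarrow> real"
  assumes deriv: "\<And>t. (F has_field_derivative f t) (at t)"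
    and int: "set_integrable lebesgue {0..} f" and decay: "exp_decaying F"
  shows "integral {0..} f = - F 0"
proof -
  have "((\<lambda>b. set_lebesgue_integral lebesgue {0..b} f) \<longlongrightarrow> integral {0..} f) at_top"
    using tendsto_set_lebesgue_integral_at_top[OF _ int]
    by (simp add: set_lebesgue_integral_eq_integral(2)[OF int])
  moreover have "\<forall>\<^sub>F b in at_top. set_lebesgue_integral lebesgue {0..b} f = F b - F 0"
  proof (rule eventually_at_top_linorderI)
    fix b :: real assume b: "0 \<le> b"
    have "set_integrable lebesgue {0..b} f"
      by (rule set_integrable_subset[OF int]) auto
    moreover have "(f has_integral F b - F 0) {0..b}"
      using deriv b by (intro fundamental_theorem_of_calculus)
        (auto simp: has_real_derivative_iff_has_vector_derivative[symmetric] intro: DERIV_subset)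
    ultimately show "set_lebesgue_integral lebesgue {0..b} f = F b - F 0"
      by (simp add: set_lebesgue_integral_eq_integral(2) integral_unique)
  qed
  ultimately have "((\<lambda>b. F b - F 0) \<longlongrightarrow> integral {0..} f) at_top"
    by (rule Lim_transform_eventually)
  moreover have "((\<lambda>b. F b - F 0) \<longlongrightarrow> 0 - F 0) at_top"
    by (intro tendsto_diff exp_decaying_tendsto_0 decay tendsto_const)
  ultimately show ?thesis
    by (metis diff_0 tendsto_unique trivial_limit_at_top_linorder)
qed

section \<open>Entries of the matrices \<open>W_node A i\<close> and the Lyapunov equation\<close>

text \<open>The integrand is \<open>x x^T\<close>, where \<open>x\<close> is the \<open>i\<close>-th
  column of \<open>exp (t A)\<close>, since the exponential of the transpose is the
  transpose.\<close>

lemma W_node_integrand_entry: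
  fixes A :: "real^'n^'n"
  shows "(matrix_exp (t *\<^sub>R A) **
       ((columnvector (axis i 1) :: real^1^'n) ** (rowvector (axis i 1) :: real^'n^1)) **
     matrix_exp (t *\<^sub>R transpose A)) $ k $ l
   = matrix_exp (t *\<^sub>R A) $ k $ i * matrix_exp (t *\<^sub>R A) $ l $ i"
proof -
  have sum_axis: "(\<Sum>m\<in>UNIV. f m * axis i 1 $ m) = f i" for f :: "'n \<Rightarrow> real"
    by (simp add: axis_def if_distrib[of "\<lambda>x. _ * x"] cong: if_cong)
  define E where "E = matrix_exp (t *\<^sub>R A)"
  have "t *\<^sub>R transpose A = transpose (t *\<^sub>R A)"
    by (simp add: transpose_def vec_eq_iff)
  then have E': "matrix_exp (t *\<^sub>R transpose A) = transpose E"
    by (simp add: matrix_exp_transpose E_def)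
  have "(E ** ((columnvector (axis i 1) :: real^1^'n) ** (rowvector (axis i 1) :: real^'n^1))) $ k $ m
      = E $ k $ i * axis i 1 $ m" for m
    unfolding matrix_matrix_mult_def columnvector_def rowvector_def
    by (simp add: mult.assoc[symmetric] sum_distrib_right[symmetric] sum_axis)
  then show ?thesis
    unfolding E' E_def[symmetric] matrix_matrix_mult_def[of _ "transpose E"]
    using sum_axis[of "\<lambda>m. E $ k $ i * E $ l $ m"] by (simp add: transpose_def mult_ac)
qed

lemma continuous_on_matrix_exp_entry: "continuous_on S (\<lambda>t. matrix_exp (t *\<^sub>R A) $ i $ j)"
  by (intro continuous_at_imp_continuous_on ballI DERIV_isCont[OF matrix_exp_entry_has_derivative])

context
  fixes A :: "real^'n^'n"
  assumes stable: "stable_matrix A"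
begin

lemma matrix_exp_entries_integrable:
  "set_integrable lebesgue {0..} (\<lambda>t. matrix_exp (t *\<^sub>R A) $ k $ i * matrix_exp (t *\<^sub>R A) $ l $ j)"
  by (intro absolutely_integrable_exp_decaying exp_decaying_mult stable_matrix_exp_decaying stable
      continuous_on_mult continuous_on_matrix_exp_entry)

lemma W_node_entry:
  "W_node A i $ k $ l =
    integral {0..} (\<lambda>t. matrix_exp (t *\<^sub>R A) $ k $ i * matrix_exp (t *\<^sub>R A) $ l $ i)"
proof -
  let ?G = "\<lambda>t. matrix_exp (t *\<^sub>R A) **
       ((columnvector (axis i 1) :: real^1^'n) ** (rowvector (axis i 1) :: real^'n^1)) **
     matrix_exp (t *\<^sub>R transpose A)"
  \<comment> \<open>\<open>integral\<close> has a default value on functions that are not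
    integrable, so integrability comes before taking entries under the integral.\<close>
  have "?G integrable_on {0..}"
  proof (rule integrable_componentwise)
    fix b :: "real^'n^'n" assume "b \<in> Basis"
    then obtain k l where "b = axis k (axis l 1)"
      by (auto simp: Basis_vec_def)
    then show "(\<lambda>t. ?G t \<bullet> b) integrable_on {0..}"
      by (simp add: inner_axis W_node_integrand_entry
          set_lebesgue_integral_eq_integral(1)[OF matrix_exp_entries_integrable])
  qed
  from integral_linear[OF this bounded_linear_matrix_entry[of k l]] show ?thesis
    by (simp add: W_node_def o_def W_node_integrand_entry)
qed

text \<open>For \<open>x = exp (t A) e_i\<close> the derivative of \<open>x x^T\<close> is
  \<open>A x x^T + x x^T A^T\<close>. Integrating over the half-line leaves minus the value at 0,
  where \<open>x = e_i\<close>.\<close>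

lemma lyapunov_W_node:
  "(A ** W_node A i + W_node A i ** transpose A) $ k $ l = - (axis i 1 $ k * axis i 1 $ l)"
proof -
  let ?x = "\<lambda>k t. matrix_exp (t *\<^sub>R A) $ k $ i"
  let ?f = "\<lambda>t. (\<Sum>m\<in>UNIV. A $ k $ m * (?x m t * ?x l t)) + (\<Sum>m\<in>UNIV. A $ l $ m * (?x k t * ?x m t))"
  note int = matrix_exp_entries_integrable
  note int' = set_lebesgue_integral_eq_integral(1)[OF int]
  have "((\<lambda>t. ?x k t * ?x l t) has_field_derivative ?f t) (at t)" for t
    by (rule DERIV_cong[OF DERIV_mult[OF matrix_exp_entry_has_derivative matrix_exp_entry_has_derivative]])
      (simp add: matrix_matrix_mult_def sum_distrib_left sum_distrib_right mult_ac)
  moreover have "set_integrable lebesgue {0..} ?f"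
    by (intro set_integral_add absolutely_integrable_sum set_integrable_mult_right int) auto
  moreover have "exp_decaying (\<lambda>t. ?x k t * ?x l t)"
    by (intro exp_decaying_mult stable_matrix_exp_decaying stable)
  ultimately have "integral {0..} ?f = - (?x k 0 * ?x l 0)"
    by (rule integral_derivative_exp_decaying)
  also have "integral {0..} ?f = (\<Sum>m\<in>UNIV. A $ k $ m * W_node A i $ m $ l)
      + (\<Sum>m\<in>UNIV. A $ l $ m * W_node A i $ k $ m)"
    by (simp add: integral_add integral_sum integrable_sum integrable_on_mult_right int' W_node_entry)
  also have "\<dots> = (A ** W_node A i + W_node A i ** transpose A) $ k $ l"
    by (simp add: matrix_matrix_mult_def transpose_def mult.commute)
  also have "?x k 0 * ?x l 0 = axis i 1 $ k * axis i 1 $ l"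
    using matrix_exp_0[of A] by (simp add: mat_def axis_def)
  finally show ?thesis .
qed

text \<open>The left side is linear in \<open>W\<close>, so the equations for the single nodes add
  up with weights \<open>p\<close>. The diagonal then recovers \<open>p\<close> from
  \<open>W_con A p\<close>, which gives injectivity.\<close>

lemma lyapunov_W_con:
  "(A ** W_con A p + W_con A p ** transpose A) $ i $ i = - (p $ i)"
proof -
  have "bounded_linear (\<lambda>W. (A ** W + W ** transpose A) $ i $ i)"
    by (intro bounded_linear_compose[OF bounded_linear_matrix_entry] bounded_linear_add
        bounded_linear_matrix_mult_left bounded_linear_matrix_mult_right)
  then interpret bounded_linear "\<lambda>W. (A ** W + W ** transpose A) $ i $ i" .
  have "(A ** W_con A p + W_con A p ** transpose A) $ i $ i =
      (\<Sum>j\<in>UNIV. p $ j * (A ** W_node A j + W_node A j ** transpose A) $ i $ i)"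
    unfolding W_con_def sum scaleR by simp
  also have "\<dots> = - (p $ i)"
    unfolding lyapunov_W_node
    by (simp add: axis_def if_distrib[of "\<lambda>x. _ * x"] sum_negf cong: if_cong)
  finally show ?thesis .
qed

lemma inj_W_con: "inj (W_con A)"
  by (rule injI) (metis lyapunov_W_con neg_equal_iff_equal vec_eq_iff)

end

section \<open>Convexity of the domain and conclusion\<close>

lemma W_con_combination: "W_con A (u *\<^sub>R p + v *\<^sub>R q) = u *\<^sub>R W_con A p + v *\<^sub>R W_con A q"
  by (simp add: W_con_def scaleR_left_distrib sum.distrib scaleR_sum_right)

lemma convex_\<Delta>: "convex \<Delta>"
  by (auto simp: convex_def \<Delta>_def sum.distrib sum_distrib_left[symmetric])

lemma convex_X_con: "convex (X_con A)"
proof (rule convexI)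
  fix p q u v
  assume p: "p \<in> X_con A" and q: "q \<in> X_con A" and uv: "0 \<le> u" "0 \<le> v" "u + v = (1::real)"
  show "u *\<^sub>R p + v *\<^sub>R q \<in> X_con A"
  \<comment> \<open>\<open>positive_definite_add\<close> asks for positive weights; with a zero
    weight the combination is one of the endpoints.\<close>
  proof (cases "u = 0 \<or> v = 0")
    case True
    then show ?thesis using p q uv by auto
  next
    case False
    then show ?thesis
      using p q uv by (auto simp: X_con_def W_con_combination intro: positive_definite_add)
  qed
qed

theorem theorem3:
  fixes A :: "real^'n^'n"
  assumes "stable_matrix A"
  shows "strictly_convex_on (\<F> A) (g_con A)"
  unfolding strictly_convex_on_def
proof (intro conjI ballI impI allI)
  show "convex (\<F> A)"
    unfolding \<F>_def by (intro convex_Int convex_X_con convex_\<Delta>)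
  fix p q :: "real^'n" and u v :: real
  assume pq: "p \<in> \<F> A" "q \<in> \<F> A" "p \<noteq> q" and uv: "0 < u" "0 < v" "u + v = 1"
  \<comment> \<open>Strictness for the trace needs distinct matrices; injectivity provides them from
    \<open>p \<noteq> q\<close>.\<close>
  have "W_con A p \<noteq> W_con A q"
    using inj_W_con[OF assms] \<open>p \<noteq> q\<close> by (auto dest: injD)
  then show "g_con A (u *\<^sub>R p + v *\<^sub>R q) < u * g_con A p + v * g_con A q"
    unfolding g_con_def W_con_combination
    using pq uv by (intro trace_inverse_strictly_convex) (auto simp: \<F>_def X_con_def)
qed

end
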